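(* Let $k>1$ be an integer, let ${\tt w}_{\rm TM}$ be the Thue--Morse word, and let ${\tt w}=\phi_k({\tt w}_{\rm TM})$. Identify ${\tt a}=k$ and ${\tt b}=-k$. Then ${\tt w}$ is the only word ${\tt v}=\ell_0\ell_1\cdots\in\mathcal{W}$ starting with ${\tt a}=k$ such that ${\tt v}=r_{\tt v}(1)r_{\tt v}(2)\cdots r_{\tt v}(n)\cdots$, i.e. $\ell_{n-1}=r_{\tt v}(n)$ for all $n\geqslant1$.
   Context: Words are infinite one-sided words over $\{{\tt a},{\tt b}\}$ indexed from position $0$; $\mathcal{W}$ is the set of such words in which both letters occur infinitely often. $p_{\tt a}(n)$, $p_{\tt b}(n)$ are the positions of the $n$-th ${\tt a}$ and $n$-th ${\tt b}$, and $r_{\tt v}(n)=p_{\tt b}(n)-p_{\tt a}(n)$. The Thue--Morse word ${\tt w}_{\rm TM}$ is the fixed point starting with ${\tt a}$ of ${\tt a}\mapsto{\tt a}{\tt b},\ {\tt b}\mapsto{\tt b}{\tt a}$. The cloning substitution $\phi_k$ maps ${\tt a}\mapsto{\tt a}^k$, ${\tt b}\mapsto{\tt b}^k$. *)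

theory Defs
  imports Complex_Main "HOL-Library.Infinite_Set"
begin

datatype letter = A | B

type_synonym inf_word = "nat \<Rightarrow> letter"

definition both_inf :: "inf_word set" where
  "both_inf = {v. infinite {i. v i = A} \<and> infinite {i. v i = B}}"

text \<open>Occurrences are counted from \<open>n = 1\<close>, positions from \<open>0\<close>.\<close>
definition pos :: "letter \<Rightarrow> inf_word \<Rightarrow> nat \<Rightarrow> nat" where
  "pos c v n = enumerate {i. v i = c} (n - 1)"

definition rdiff :: "inf_word \<Rightarrow> nat \<Rightarrow> int" where
  "rdiff v n = int (pos B v n) - int (pos A v n)"

text \<open>The image of an infinite word under a non-erasing substitution: the first \<open>i + 1\<close>
  letters have an image of length greater than \<open>i\<close>, so letter \<open>i\<close> can be read off there.\<close>
definition subst_word :: "(letter \<Rightarrow> letter list) \<Rightarrow> inf_word \<Rightarrow> inf_word" where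
  "subst_word \<sigma> w i = concat (map (\<lambda>j. \<sigma> (w j)) [0..<Suc i]) ! i"

fun tm_subst :: "letter \<Rightarrow> letter list" where
  "tm_subst A = [A, B]"
| "tm_subst B = [B, A]"

text \<open>Well defined by lemma \<open>thue_morse_ex1\<close> below.\<close>
definition thue_morse :: inf_word where
  "thue_morse = (THE w. w 0 = A \<and> subst_word tm_subst w = w)"

definition clone :: "nat \<Rightarrow> letter \<Rightarrow> letter list" where
  "clone k c = replicate k c"

fun letter_val :: "nat \<Rightarrow> letter \<Rightarrow> int" where
  "letter_val k A = int k"
| "letter_val k B = - int k"

lemma concat_uniform_nth:
  assumes "\<And>c. length (\<sigma> c) = k" "k > 0" "i < k * m"
  shows "concat (map (\<lambda>j. \<sigma> (w j)) [0..<m]) ! i = \<sigma> (w (i div k)) ! (i mod k)"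
  using assms(3)
proof (induction m)
  case 0
  then show ?case by simp
next
  case (Suc m)
  have len: "length (concat (map (\<lambda>j. \<sigma> (w j)) [0..<m])) = k * m"
    by (induction m) (auto simp: assms(1))
  show ?case
  proof (cases "i < k * m")
    case True
    then show ?thesis using Suc.IH by (simp add: nth_append len)
  next
    case False
    then have i: "i = k * m + (i - k * m)" and lt: "i - k * m < k" using Suc.prems by auto
    have "i div k = m" by (subst i) (use lt assms(2) in simp)
    moreover have "i mod k = i - k * m" by (metis calculation minus_mult_div_eq_mod)
    ultimately show ?thesis using False by (simp add: nth_append len)
  qed
qed

lemma subst_word_uniform:
  assumes "\<And>c. length (\<sigma> c) = k" "k > 0"
  shows "subst_word \<sigma> w i = \<sigma> (w (i div k)) ! (i mod k)"
proof -
  have "i < k * Suc i" using assms(2) by (cases k) auto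
  then show ?thesis unfolding subst_word_def by (intro concat_uniform_nth assms)
qed

lemma length_tm_subst: "length (tm_subst c) = 2"
  by (cases c) auto

lemma thue_morse_ex1: "\<exists>!w. w 0 = A \<and> subst_word tm_subst w = w"
proof -
  have sub: "subst_word tm_subst w i = tm_subst (w (i div 2)) ! (i mod 2)" for w i
    by (rule subst_word_uniform) (auto simp: length_tm_subst)
  define f where
    "f = wfrec less_than (\<lambda>f n. if n = 0 then A else tm_subst (f (n div 2)) ! (n mod 2))"
  have f: "f n = (if n = 0 then A else tm_subst (f (n div 2)) ! (n mod 2))" for n
    unfolding f_def by (subst wfrec) (auto simp: cut_def)
  show ?thesis
  proof (rule ex1I[of _ f])
    have "subst_word tm_subst f i = f i" for i
      using f[of i] f[of 0] by (cases "i = 0") (simp_all add: sub)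
    then show "f 0 = A \<and> subst_word tm_subst f = f" using f[of 0] by auto
  next
    fix w assume w: "w 0 = A \<and> subst_word tm_subst w = w"
    have "w n = f n" for n
    proof (induction n rule: less_induct)
      case (less n)
      show ?case
      proof (cases "n = 0")
        case True
        then show ?thesis using w f[of 0] by simp
      next
        case False
        then have "w (n div 2) = f (n div 2)" by (intro less) auto
        then show ?thesis using sub[of w n] w f[of n] False by simp
      qed
    qed
    then show "w = f" by auto
  qed
qed

end

theory Submission
  imports Defs
begin

text \<open>
  The word \<open>\<phi>\<^sub>k(w\<^sub>T\<^sub>M)\<close> is a concatenation of blocks \<open>c\<^sup>k d\<^sup>k\<close> of length \<open>2k\<close> with
  \<open>{c, d} = {a, b}\<close>, where the \<open>j\<close>-th block starts with the \<open>j\<close>-th letter of the Thue--Morse word.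
  The \<open>j\<close>-th block holds the occurrences number \<open>kj, \<dots>, kj + k - 1\<close> (counted from \<open>0\<close>) of both
  letters, each pair at distance \<open>k\<close>, with sign given by \<open>c\<close>, which is also the
  letter at the positions \<open>kj, \<dots>, kj + k - 1\<close>. Conversely, once a solution is known below \<open>2kj\<close>,
  so is its letter \<open>c\<close> at these positions (for \<open>j = 0\<close> the first letter is enough). The prescribed
  differences then force the next \<open>d\<close> not to occur before \<open>2kj + k\<close>, so that
  \<open>c\<^sup>k\<close> comes first, and then place the next \<open>k\<close> occurrences of \<open>d\<close> right after it.
\<close>

section \<open>Counting letters in prefixes\<close>

definition letter_count :: "letter \<Rightarrow> inf_word \<Rightarrow> nat \<Rightarrow> nat" where
  "letter_count c v x = card {i. i < x \<and> v i = c}"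

lemma letter_count_0 [simp]: "letter_count c v 0 = 0"
  by (simp add: letter_count_def)

lemma letter_count_Suc [simp]:
  "letter_count c v (Suc x) = letter_count c v x + (if v x = c then 1 else 0)"
proof -
  have "{i. i < Suc x \<and> v i = c} = (if v x = c then insert x {i. i < x \<and> v i = c} else {i. i < x \<and> v i = c})"
    by (auto simp: less_Suc_eq)
  then show ?thesis by (simp add: letter_count_def)
qed

lemma letter_count_mono: "x \<le> y \<Longrightarrow> letter_count c v x \<le> letter_count c v y"
  unfolding letter_count_def by (intro card_mono) auto

lemma letter_count_cong: "(\<And>i. i < x \<Longrightarrow> v i = w i) \<Longrightarrow> letter_count c v x = letter_count c w x"
  unfolding letter_count_def by (intro arg_cong[where f = card]) auto

lemma letter_count_run:
  "(\<And>s. s < n \<Longrightarrow> v (x + s) = c) \<Longrightarrow>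
    letter_count d v (x + n) = letter_count d v x + (if c = d then n else 0)"
  by (induction n) auto

text \<open>Counting inverts the enumeration of occurrences, so positions can be determined by
  adding up letters over runs.\<close>

lemma letter_count_enumerate:
  assumes "infinite {i. v i = c}"
  shows "letter_count c v (enumerate {i. v i = c} n) = n"
proof -
  let ?S = "{i. v i = c}"
  have "{i. i < enumerate ?S n \<and> v i = c} = enumerate ?S ` {..<n}"
  proof (intro equalityI subsetI)
    fix i assume i: "i \<in> {i. i < enumerate ?S n \<and> v i = c}"
    then obtain m where "enumerate ?S m = i" using enumerate_Ex[OF assms, of i] by auto
    then show "i \<in> enumerate ?S ` {..<n}" using i enumerate_mono_iff[OF assms] by auto
  next
    fix i assume "i \<in> enumerate ?S ` {..<n}"
    then show "i \<in> {i. i < enumerate ?S n \<and> v i = c}"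
      using enumerate_in_set[OF assms] enumerate_mono_iff[OF assms] by auto
  qed
  then show ?thesis
    using inj_enumerate[OF assms] by (simp add: letter_count_def card_image inj_on_subset)
qed

lemma letter_count_pos:
  "infinite {i. v i = c} \<Longrightarrow> letter_count c v (pos c v (Suc n)) = n"
  by (simp add: pos_def letter_count_enumerate)

lemma letter_at_pos:
  "infinite {i. v i = c} \<Longrightarrow> v (pos c v n) = c"
  using enumerate_in_set[of "{i. v i = c}"] by (simp add: pos_def)

lemma pos_eqI:
  assumes "infinite {i. v i = c}" "v x = c" "letter_count c v x = n"
  shows "pos c v (Suc n) = x"
proof -
  obtain m where "enumerate {i. v i = c} m = x"
    using enumerate_Ex[OF assms(1), of x] assms(2) by auto
  then show ?thesis
    using letter_count_enumerate[OF assms(1), of m] assms(3) by (simp add: pos_def)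
qed

lemma pos_ge:
  assumes "infinite {i. v i = c}" "letter_count c v x = n"
  shows "x \<le> pos c v (Suc n)"
proof (rule ccontr)
  assume "\<not> x \<le> pos c v (Suc n)"
  then have "letter_count c v (Suc (pos c v (Suc n))) \<le> letter_count c v x"
    by (intro letter_count_mono) auto
  then show False
    using assms by (simp add: letter_count_pos letter_at_pos)
qed

text \<open>Exchanging the two letters changes the sign of both the value and the difference, so one
  statement covers both orders of letters in a block.\<close>

lemma letter_val_eq_rdiff_iff:
  "c \<noteq> d \<Longrightarrow> letter_val k c = rdiff v n \<longleftrightarrow> pos d v n = pos c v n + k"
  by (cases c; cases d) (auto simp: rdiff_def)

lemma both_inf_infinite: "v \<in> both_inf \<Longrightarrow> infinite {i. v i = c}"
  by (cases c) (auto simp: both_inf_def)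

section \<open>Thue-Morse letters at even and odd positions\<close>

lemma thue_morse_0: "thue_morse 0 = A"
  and subst_thue_morse: "subst_word tm_subst thue_morse = thue_morse"
  using theI'[OF thue_morse_ex1] unfolding thue_morse_def by auto

lemma thue_morse_rec: "thue_morse i = tm_subst (thue_morse (i div 2)) ! (i mod 2)"
  using subst_word_uniform[of tm_subst 2 thue_morse i] by (simp add: length_tm_subst subst_thue_morse)

lemma thue_morse_even: "thue_morse (2 * j) = thue_morse j"
  using thue_morse_rec[of "2 * j"] by (cases "thue_morse j") auto

lemma thue_morse_odd: "thue_morse (Suc (2 * j)) \<noteq> thue_morse j"
  using thue_morse_rec[of "Suc (2 * j)"] by (cases "thue_morse j") auto

lemma subst_clone_nth:
  assumes "k > 0"
  shows "subst_word (clone k) w i = w (i div k)"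
  using subst_word_uniform[of "clone k" k w i] assms by (simp add: clone_def)

section \<open>Block structure of the cloned word\<close>

context
  fixes k :: nat and w :: inf_word
  assumes k: "k > 0"
  defines "w \<equiv> subst_word (clone k) thue_morse"
begin

lemma cloned_first_half: "s < k \<Longrightarrow> w (2 * k * j + s) = thue_morse j"
proof -
  assume "s < k"
  then have "(2 * k * j + s) div k = 2 * j"
    by (intro div_nat_eqI) (auto simp: algebra_simps)
  then show ?thesis
    using k by (simp add: w_def subst_clone_nth thue_morse_even)
qed

lemma cloned_second_half: "s < k \<Longrightarrow> w (2 * k * j + k + s) = thue_morse (Suc (2 * j))"
proof -
  assume "s < k"
  then have "(2 * k * j + k + s) div k = Suc (2 * j)"
    by (intro div_nat_eqI) (auto simp: algebra_simps)
  then show ?thesis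
    using k by (simp add: w_def subst_clone_nth)
qed

text \<open>The word is cut here into runs of length \<open>k\<close> instead of blocks of length
  \<open>2 * k\<close>. Run \<open>j\<close> carries the letter that opens block \<open>j\<close>,
  which ties the letter at an index to the block holding the occurrences with that number.\<close>

lemma cloned_nth: "s < k \<Longrightarrow> w (k * j + s) = thue_morse j"
  using k by (simp add: w_def subst_clone_nth)

text \<open>The halves of a block carry different letters, so each block adds \<open>k\<close> to
  either count.\<close>

lemma letter_count_cloned: "letter_count c w (2 * k * j) = k * j"
proof (induction j)
  case (Suc j)
  have "letter_count c w (2 * k * j + k + k) = k * j + k"
    using letter_count_run[of k w "2 * k * j + k" "thue_morse (Suc (2 * j))" c]
      letter_count_run[of k w "2 * k * j" "thue_morse j" c]
      cloned_first_half cloned_second_half thue_morse_odd[of j] Suc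
    by (cases "thue_morse j"; cases "thue_morse (Suc (2 * j))"; cases c) auto
  then show ?case by (simp add: algebra_simps)
qed simp

lemma infinite_cloned: "infinite {i. w i = c}"
  unfolding infinite_nat_iff_unbounded_le
proof
  fix m
  have m: "m \<le> 2 * k * m" using k by simp
  have "w (2 * k * m) = c \<or> w (2 * k * m + k) = c"
    using cloned_first_half[of 0 m] cloned_second_half[of 0 m] thue_morse_odd[of m] k
    by (cases "thue_morse m"; cases "thue_morse (Suc (2 * m))"; cases c) auto
  then show "\<exists>n\<ge>m. n \<in> {i. w i = c}"
    using m trans_le_add1[OF m] by blast
qed

lemma cloned_in_both_inf: "w \<in> both_inf"
  by (simp add: both_inf_def infinite_cloned)

lemma cloned_0: "w 0 = A"
  using cloned_nth[of 0 0] k by (simp add: thue_morse_0)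

lemma cloned_rdiff: "letter_val k (w m) = rdiff w (Suc m)"
proof -
  \<comment> \<open>Occurrence number \<open>m\<close> (from 0) of either letter lies in block
    \<open>j\<close>, at offset \<open>s\<close> in its half.\<close>
  define j s where "j = m div k" and "s = m mod k"
  have m: "m = k * j + s" and s: "s < k"
    using k by (auto simp: j_def s_def)
  define c d where "c = thue_morse j" and "d = thue_morse (Suc (2 * j))"
  have cd: "c \<noteq> d" using thue_morse_odd[of j] by (simp add: c_def d_def)
  have first: "w (2 * k * j + i) = c" if "i < k" for i
    using cloned_first_half that by (simp add: c_def)
  have second: "w (2 * k * j + k + i) = d" if "i < k" for i
    using cloned_second_half that by (simp add: d_def)
  have "letter_count c w (2 * k * j + s) = m"
    using letter_count_run[of s w "2 * k * j" c c] first s by (simp add: letter_count_cloned m)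
  then have "pos c w (Suc m) = 2 * k * j + s"
    using first s by (intro pos_eqI infinite_cloned) auto
  moreover have "letter_count d w (2 * k * j + k + s) = m"
    using letter_count_run[of k w "2 * k * j" c d] letter_count_run[of s w "2 * k * j + k" d d]
      first second s cd
    by (simp add: letter_count_cloned m)
  then have "pos d w (Suc m) = 2 * k * j + k + s"
    using second s by (intro pos_eqI infinite_cloned) auto
  ultimately have "letter_val k c = rdiff w (Suc m)"
    by (simp add: letter_val_eq_rdiff_iff[OF cd])
  then show ?thesis
    using cloned_nth[OF s, of j] by (simp add: m c_def)
qed

section \<open>Uniqueness, block by block\<close>

lemma self_describing_eq_cloned:
  assumes "v \<in> both_inf" and v0: "v 0 = A"
    and rdiff: "\<And>m. letter_val k (v m) = rdiff v (Suc m)"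
  shows "v = w"
proof -
  have inf: "infinite {i. v i = c}" for c
    using assms(1) by (rule both_inf_infinite)
  have "\<forall>i < 2 * k * j. v i = w i" for j
  proof (induction j)
    case (Suc j)
    define x where "x = 2 * k * j"
    define c d where "c = thue_morse j" and "d = thue_morse (Suc (2 * j))"
    have cd: "c \<noteq> d" using thue_morse_odd[of j] by (simp add: c_def d_def)
    have count: "letter_count e v x = k * j" for e
      using letter_count_cong[of x v w e] Suc by (simp add: x_def letter_count_cloned)
    \<comment> \<open>For \<open>j > 0\<close> these indices lie below \<open>2 * k * j\<close>, in
      the known prefix. For \<open>j = 0\<close> they lie in the block still to be
      determined.\<close>
    have known: "v (k * j + s) = c" if "s < k" "j > 0" for s
    proof -
      have "k * j + s < k * j + k" using that by simp
      also have "\<dots> \<le> 2 * k * j" using that k by (cases j) (auto simp: algebra_simps)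
      finally show ?thesis
        using Suc cloned_nth[OF that(1), of j] by (simp add: c_def)
    qed
    have dist: "pos d v (Suc m) = pos c v (Suc m) + k" if "v m = c" for m
      using rdiff[of m] that letter_val_eq_rdiff_iff[OF cd] by simp
    have "v (k * j) = c"
      using known[of 0] k v0 by (cases "j = 0") (auto simp: c_def thue_morse_0)
    \<comment> \<open>The next \<open>c\<close> is not before \<open>x\<close>, and the matching
      \<open>d\<close> comes \<open>k\<close> later.\<close>
    then have next_d: "x + k \<le> pos d v (Suc (k * j))"
      using dist pos_ge[OF inf count] by simp
    have first: "v (x + s) = c" if "s < k" for s
      using that
    proof (induction s rule: less_induct)
      case (less s)
      show ?case
      \<comment> \<open>The first other letter in this half would be the next \<open>d\<close>, too
        early for \<open>next_d\<close>.\<close>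
      proof (rule ccontr)
        assume "v (x + s) \<noteq> c"
        then have "v (x + s) = d" using cd by (cases "v (x + s)"; cases c; cases d) auto
        moreover have "letter_count d v (x + s) = k * j"
          using letter_count_run[of s v x c d] less cd by (simp add: count)
        ultimately have "pos d v (Suc (k * j)) = x + s"
          by (intro pos_eqI inf)
        then show False using next_d less.prems by simp
      qed
    qed
    have second: "v (x + k + s) = d" if "s < k" for s
    proof -
      \<comment> \<open>If \<open>j = 0\<close>, then \<open>x = 0\<close> and these indices form
        the half just settled.\<close>
      have "v (k * j + s) = c"
        using known[OF that] first[OF that] by (cases "j = 0") (auto simp: x_def)
      moreover have "letter_count c v (x + s) = k * j + s"
        using letter_count_run[of s v x c c] first that by (simp add: count)
      then have "pos c v (Suc (k * j + s)) = x + s"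
        using first that by (intro pos_eqI inf)
      ultimately have "pos d v (Suc (k * j + s)) = x + k + s"
        using dist by simp
      then show ?thesis
        using letter_at_pos[OF inf, of d] by metis
    qed
    show ?case
    proof (intro allI impI)
      fix i assume i: "i < 2 * k * Suc j"
      consider "i < x" | s where "i = x + s" "s < k" | s where "i = x + k + s" "s < k"
      proof (cases "i < x + k")
        case True
        then show ?thesis
          using that(1) that(2)[of "i - x"] by force
      next
        case False
        then show ?thesis
          using that(3)[of "i - (x + k)"] i by (simp add: x_def algebra_simps)
      qed
      then show "v i = w i"
      proof cases
        case 1
        then show ?thesis using Suc by (simp add: x_def)
      next
        case 2
        then show ?thesis using first cloned_first_half by (simp add: x_def c_def)
      next
        case 3
        then show ?thesis using second cloned_second_half by (simp add: x_def d_def)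
      qed
    qed
  qed simp
  \<comment> \<open>Taking \<open>j = Suc i\<close> puts index \<open>i\<close> into a settled
    prefix.\<close>
  moreover have "i < 2 * k * Suc i" for i
    using k by (cases k) auto
  ultimately show ?thesis by blast
qed

end

theorem theorem6p5:
  fixes k :: nat and v :: inf_word
  assumes "k > 1"
  shows "(v \<in> both_inf \<and> v 0 = A \<and> (\<forall>n\<ge>1. letter_val k (v (n - 1)) = rdiff v n))
    \<longleftrightarrow> v = subst_word (clone k) thue_morse"
proof -
  have k: "k > 0" using assms by simp
  have "(\<forall>n\<ge>1. letter_val k (v (n - 1)) = rdiff v n) \<longleftrightarrow>
      (\<forall>m. letter_val k (v m) = rdiff v (Suc m))"
    by (metis One_nat_def Suc_le_D diff_Suc_1 le_add1 plus_1_eq_Suc)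
  then show ?thesis
    using self_describing_eq_cloned[OF k] cloned_in_both_inf[OF k] cloned_0[OF k] cloned_rdiff[OF k]
    by blast
qed

end
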